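(* Let $M$ be a 2-connected matroid on a finite set $E$ with rank function $r$, and let $\mathcal{P}\subseteq\mathcal{P}(M)$, $\mathcal{S}\subseteq\mathcal{S}(M)$ and $\mathcal{L}\subseteq\mathcal{L}(M)$. A minimal description of the bases polytope $P(M)$ is the set of all $x\in\mathbb{R}^E$ satisfying $x(E)=r(E)$ and the following constraints: $x(P)\leq 1$ for any $P\in\mathcal{P}$, and $x(E\backslash P)\geq r(E)-1$ for any $P\in\mathcal{P}(M)\backslash\mathcal{P}$; $x(S)\geq |S|-1$ for any $S\in\mathcal{S}$, and $x(E\backslash S)\leq r(E\backslash S)$ for any $S\in\mathcal{S}(M)\backslash\mathcal{S}$; $x(L)\leq r(L)$ for any $L\in\mathcal{L}$, and $x(E\backslash L)\geq r(E)-r(L)$ for any $L\in\mathcal{L}(M)\backslash\mathcal{L}$.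
   Context: $P(M)$ is the convex hull in $\mathbb{R}^E$ of the characteristic vectors of all bases of $M$. For $x\in\mathbb{R}^E$ and $F\subseteq E$, $x(F)=\sum_{e\in F}x(e)$. A description of a polytope by a system of linear equations and inequalities is minimal if the polytope is exactly the solution set of the system and no constraint can be removed without changing the solution set (so the inequalities describe the facets). A matroid $M$ on $E$ is disconnected if there is a proper nonempty subset $X\subset E$ with $r(E)=r(X)+r(E\backslash X)$; otherwise it is 2-connected. $M^*$ is the dual matroid, with rank function $r^*(X)=|X|-r(E)+r(E\backslash X)$; $M|X$, $M\backslash X$, $M/X$ denote restriction, deletion and contraction. A parallel closure of $M$ is a maximal subset $P\subseteq E$ with $r(P)=1$ and $r(\{e\})=1$ for every $e\in P$. A coparallel closure of $M$ is a parallel closure of $M^*$. For $M$ 2-connected, a parallel closure $P$ is essential if $M/P$ is 2-connected, and a coparallel closure $S$ is essential if $M\backslash S$ is 2-connected. A subset $L\subset E$ is a locked subset of $M$ if $M|L$ and $M^*|(E\backslash L)$ are both 2-connected and $\min\{r(L),r^*(E\backslash L)\}\geq 2$. $\mathcal{P}(M)$, $\mathcal{S}(M)$ and $\mathcal{L}(M)$ denote the classes of essential parallel closures, essential coparallel closures and locked subsets of $M$, respectively.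
   Formalization: |E|=2 is excluded (for U_{1,2} the constraints give a line, not P(M)); minimality is claimed only if, for complementary essential P and S=E\P, exactly one of P∈𝒫, S∈𝒮 holds (else the facet is listed twice and is redundant). The empty matroid is not 2-connected. *)

theory Defs
  imports "HOL-Analysis.Analysis"
begin

text \<open>A matroid is given by a finite ground set and a rank function, whose values outside the
  subsets of the ground set are irrelevant. The minors and the dual of a matroid are again such
  pairs; in particular \<open>M|X\<close> is just \<open>(X, r)\<close> and \<open>M \ X\<close> is \<open>(E - X, r)\<close>.\<close>

definition matroid :: "'a set \<Rightarrow> ('a set \<Rightarrow> nat) \<Rightarrow> bool" where
  "matroid E r \<longleftrightarrow> finite E \<and>
     (\<forall>X\<subseteq>E. r X \<le> card X) \<and>
     (\<forall>X Y. X \<subseteq> Y \<and> Y \<subseteq> E \<longrightarrow> r X \<le> r Y) \<and>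
     (\<forall>X\<subseteq>E. \<forall>Y\<subseteq>E. r (X \<union> Y) + r (X \<inter> Y) \<le> r X + r Y)"

definition indep :: "'a set \<Rightarrow> ('a set \<Rightarrow> nat) \<Rightarrow> 'a set \<Rightarrow> bool" where
  "indep E r I \<longleftrightarrow> I \<subseteq> E \<and> r I = card I"

definition basis :: "'a set \<Rightarrow> ('a set \<Rightarrow> nat) \<Rightarrow> 'a set \<Rightarrow> bool" where
  "basis E r B \<longleftrightarrow> indep E r B \<and> (\<forall>I. indep E r I \<and> B \<subseteq> I \<longrightarrow> I = B)"

text \<open>The order of the summands keeps the subtraction on \<open>nat\<close> exact:
  \<open>r E \<le> r X + r (E - X) \<le> card X + r (E - X)\<close>.\<close>

definition dual_rank :: "'a set \<Rightarrow> ('a set \<Rightarrow> nat) \<Rightarrow> 'a set \<Rightarrow> nat" where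
  "dual_rank E r X = card X + r (E - X) - r E"

text \<open>Rank function of \<open>M/X\<close>, on the ground set \<open>E - X\<close>.\<close>

definition contract_rank :: "('a set \<Rightarrow> nat) \<Rightarrow> 'a set \<Rightarrow> 'a set \<Rightarrow> nat" where
  "contract_rank r X Y = r (Y \<union> X) - r X"

definition disconnected_matroid :: "'a set \<Rightarrow> ('a set \<Rightarrow> nat) \<Rightarrow> bool" where
  "disconnected_matroid E r \<longleftrightarrow> (\<exists>X. X \<noteq> {} \<and> X \<subset> E \<and> r E = r X + r (E - X))"

text \<open>The matroid on the empty set is by convention not 2-connected. Hence a parallel closure
  \<open>P = E\<close> is never essential; its inequality \<open>x(E) \<le> 1\<close> would be implied by \<open>x(E) = r(E)\<close>.\<close>

definition two_connected :: "'a set \<Rightarrow> ('a set \<Rightarrow> nat) \<Rightarrow> bool" where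
  "two_connected E r \<longleftrightarrow> E \<noteq> {} \<and> \<not> disconnected_matroid E r"

definition parallel_closure :: "'a set \<Rightarrow> ('a set \<Rightarrow> nat) \<Rightarrow> 'a set \<Rightarrow> bool" where
  "parallel_closure E r P \<longleftrightarrow>
     P \<subseteq> E \<and> r P = 1 \<and> (\<forall>e\<in>P. r {e} = 1) \<and>
     (\<forall>Q. P \<subseteq> Q \<and> Q \<subseteq> E \<and> r Q = 1 \<and> (\<forall>e\<in>Q. r {e} = 1) \<longrightarrow> Q = P)"

definition coparallel_closure :: "'a set \<Rightarrow> ('a set \<Rightarrow> nat) \<Rightarrow> 'a set \<Rightarrow> bool" where
  "coparallel_closure E r S \<longleftrightarrow> parallel_closure E (dual_rank E r) S"

definition essential_parallel_closures :: "'a set \<Rightarrow> ('a set \<Rightarrow> nat) \<Rightarrow> 'a set set" where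
  "essential_parallel_closures E r =
     {P. parallel_closure E r P \<and> two_connected (E - P) (contract_rank r P)}"

definition essential_coparallel_closures :: "'a set \<Rightarrow> ('a set \<Rightarrow> nat) \<Rightarrow> 'a set set" where
  "essential_coparallel_closures E r =
     {S. coparallel_closure E r S \<and> two_connected (E - S) r}"

definition locked_subsets :: "'a set \<Rightarrow> ('a set \<Rightarrow> nat) \<Rightarrow> 'a set set" where
  "locked_subsets E r =
     {L. L \<subset> E \<and> two_connected L r \<and> two_connected (E - L) (dual_rank E r) \<and>
         min (r L) (dual_rank E r (E - L)) \<ge> 2}"

text \<open>For the polytope the ground set is the index type of \<open>real ^ 'e\<close>, that is \<open>E = UNIV\<close>.\<close>

definition char_vec :: "'e::finite set \<Rightarrow> real ^ 'e" where
  "char_vec F = (\<chi> e. if e \<in> F then 1 else 0)"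

definition bases_polytope :: "('e::finite set \<Rightarrow> nat) \<Rightarrow> (real ^ 'e) set" where
  "bases_polytope r = convex hull (char_vec ` {B. basis UNIV r B})"

definition vsum :: "real ^ 'e \<Rightarrow> 'e::finite set \<Rightarrow> real" where
  "vsum x F = (\<Sum>e\<in>F. x $ e)"

text \<open>A linear constraint is represented by the hyperplane or half-space that it describes, and
  a system by the set of its constraints.\<close>

definition describes :: "'v set set \<Rightarrow> 'v set \<Rightarrow> bool" where
  "describes C Q \<longleftrightarrow> \<Inter> C = Q"

definition minimal_description :: "'v set set \<Rightarrow> 'v set \<Rightarrow> bool" where
  "minimal_description C Q \<longleftrightarrow> describes C Q \<and> (\<forall>c\<in>C. \<Inter> (C - {c}) \<noteq> \<Inter> C)"

definition bases_system ::
    "('e::finite set \<Rightarrow> nat) \<Rightarrow> 'e set set \<Rightarrow> 'e set set \<Rightarrow> 'e set set \<Rightarrow> (real ^ 'e) set set" where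
  "bases_system r \<P> \<S> \<L> =
     {{x. vsum x UNIV = real (r UNIV)}}
     \<union> {{x. vsum x P \<le> 1} | P. P \<in> \<P>}
     \<union> {{x. vsum x (UNIV - P) \<ge> real (r UNIV) - 1} | P. P \<in> essential_parallel_closures UNIV r - \<P>}
     \<union> {{x. vsum x S \<ge> real (card S) - 1} | S. S \<in> \<S>}
     \<union> {{x. vsum x (UNIV - S) \<le> real (r (UNIV - S))} | S.
          S \<in> essential_coparallel_closures UNIV r - \<S>}
     \<union> {{x. vsum x L \<le> real (r L)} | L. L \<in> \<L>}
     \<union> {{x. vsum x (UNIV - L) \<ge> real (r UNIV) - real (r L)} | L. L \<in> locked_subsets UNIV r - \<L>}"

text \<open>An essential parallel closure \<open>P\<close> and an essential coparallel closure \<open>S\<close> may be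
  complementary (a triangle with one doubled edge). Then \<open>|S| = r(E)\<close> and \<open>P\<close> and \<open>S\<close> give the
  same facet: the forms for \<open>P \<in> \<P>\<close> and for \<open>S \<notin> \<S>\<close> are both \<open>x(P) \<le> 1\<close>, the forms for
  \<open>P \<notin> \<P>\<close> and for \<open>S \<in> \<S>\<close> are both \<open>x(S) \<ge> r(E) - 1\<close>. The following says that such a facet is
  not written in both forms, one of which would be redundant.\<close>

definition no_facet_twice ::
    "('e::finite set \<Rightarrow> nat) \<Rightarrow> 'e set set \<Rightarrow> 'e set set \<Rightarrow> bool" where
  "no_facet_twice r \<P> \<S> \<longleftrightarrow>
     (\<forall>P\<in>essential_parallel_closures UNIV r. \<forall>S\<in>essential_coparallel_closures UNIV r.
        S = UNIV - P \<longrightarrow> (P \<in> \<P> \<longleftrightarrow> S \<notin> \<S>))"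

end

theory Submission
  imports Defs
begin

text \<open>By the greedy algorithm and a separating hyperplane, \<open>P(M)\<close> is given by \<open>x(E) = r(E)\<close>
  and \<open>x(F) \<le> r(F)\<close> for all \<open>F\<close>. The slack \<open>r(F) - x(F)\<close> is additive along separations of
  \<open>M|F\<close> and of \<open>M/F\<close>, so that only the flacets are needed: the proper \<open>F\<close> for which both \<open>M|F\<close>
  and \<open>M/F\<close> are 2-connected. For \<open>|E| \<noteq> 2\<close> the essential parallel closures \<open>P\<close>, the
  complements of the essential coparallel closures \<open>S\<close> and the locked subsets \<open>L\<close> are exactly
  the flacets, with \<open>r(P) = 1\<close>, with \<open>r*(S) = 1\<close>, and with both ranks at least 2. A flacet \<open>F\<close>
  is recovered from the bases \<open>B\<close> with \<open>|B \<inter> F| = r(F)\<close>; moving their centroid slightly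
  outwards violates the constraint of \<open>F\<close> alone.\<close>

definition flacet :: "'a set \<Rightarrow> ('a set \<Rightarrow> nat) \<Rightarrow> 'a set \<Rightarrow> bool" where
  "flacet E r F \<longleftrightarrow>
     F \<subset> E \<and> two_connected F r \<and> two_connected (E - F) (contract_rank r F)"

lemma card_eq_add_Diff: "finite Y \<Longrightarrow> X \<subseteq> Y \<Longrightarrow> card Y = card X + card (Y - X)"
  by (simp add: card_Diff_subset card_mono finite_subset)

section \<open>Rank axioms, independent sets and bases\<close>

locale matroid_rank =
  fixes E :: "'a set" and r :: "'a set \<Rightarrow> nat"
  assumes matroid: "matroid E r"
begin

lemma finite_ground: "finite E"
  using matroid by (simp add: matroid_def)

lemma finite_sub: "X \<subseteq> E \<Longrightarrow> finite X"
  using finite_ground finite_subset by blast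

lemma rank_le_card: "X \<subseteq> E \<Longrightarrow> r X \<le> card X"
  using matroid by (simp add: matroid_def)

lemma rank_mono: "X \<subseteq> Y \<Longrightarrow> Y \<subseteq> E \<Longrightarrow> r X \<le> r Y"
  using matroid by (simp add: matroid_def)

lemma rank_submodular: "X \<subseteq> E \<Longrightarrow> Y \<subseteq> E \<Longrightarrow> r (X \<union> Y) + r (X \<inter> Y) \<le> r X + r Y"
  using matroid by (simp add: matroid_def)

lemma rank_empty [simp]: "r {} = 0"
  using rank_le_card[of "{}"] by simp

lemma rank_subadditive: "X \<subseteq> E \<Longrightarrow> Y \<subseteq> E \<Longrightarrow> r (X \<union> Y) \<le> r X + r Y"
  using rank_submodular[of X Y] by linarith

lemma rank_insert_le: "insert e X \<subseteq> E \<Longrightarrow> r (insert e X) \<le> r X + 1"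
  using rank_subadditive[of X "{e}"] rank_le_card[of "{e}"] by auto

text \<open>Subadditivity leaves no slack in \<open>r J \<le> card J\<close> and
  \<open>r (I - J) \<le> card (I - J)\<close>.\<close>

lemma indep_subset:
  assumes "indep E r I" "J \<subseteq> I"
  shows "indep E r J"
proof -
  have I: "I \<subseteq> E" "r I = card I" using assms by (auto simp: indep_def)
  have "r (J \<union> (I - J)) \<le> r J + r (I - J)"
    using I assms(2) by (intro rank_subadditive) auto
  moreover have "J \<union> (I - J) = I" using assms(2) by blast
  moreover have "r (I - J) \<le> card (I - J)" using I by (intro rank_le_card) auto
  moreover have "card I = card J + card (I - J)"
    using card_eq_add_Diff[OF finite_sub[OF I(1)] assms(2)] .
  moreover have "r J \<le> card J" using I assms(2) by (intro rank_le_card) auto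
  ultimately show ?thesis using I assms(2) by (auto simp: indep_def)
qed

lemma card_Int_le_rank:
  assumes "indep E r I" "X \<subseteq> E"
  shows "card (I \<inter> X) \<le> r X"
  using indep_subset[OF assms(1), of "I \<inter> X"] rank_mono[of "I \<inter> X" X] assms(2)
  by (simp add: indep_def)

text \<open>The points of \<open>X\<close> lie in the closure of \<open>J\<close>. They are added
  one at a time; submodularity of \<open>J \<union> X\<close> and \<open>insert e J\<close>, which
  meet in a superset of \<open>J\<close>, prevents an increase.\<close>

lemma rank_Un_eqI:
  assumes "J \<subseteq> E" "X \<subseteq> E" "\<And>e. e \<in> X \<Longrightarrow> r (insert e J) = r J"
  shows "r (J \<union> X) = r J"
proof -
  have "finite X" using assms(2) finite_sub by blast
  then show ?thesis using assms(2,3)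
  proof (induction X)
    case (insert e X)
    have "r ((J \<union> X) \<union> insert e J) + r ((J \<union> X) \<inter> insert e J) \<le> r (J \<union> X) + r (insert e J)"
      using insert.prems assms(1) by (intro rank_submodular) auto
    moreover have "(J \<union> X) \<union> insert e J = J \<union> insert e X" by blast
    moreover have "r J \<le> r ((J \<union> X) \<inter> insert e J)"
      using insert.prems assms(1) by (intro rank_mono) auto
    moreover have "r J \<le> r (J \<union> insert e X)"
      using insert.prems assms(1) by (intro rank_mono) auto
    moreover have "r (J \<union> X) = r J" "r (insert e J) = r J" using insert by simp_all
    ultimately show ?case by simp
  qed simp
qed

text \<open>Take \<open>J\<close> maximal among the independent sets between \<open>I\<close> and
  \<open>A\<close>. No point of \<open>A\<close> raises its rank, so \<open>J\<close> spans
  \<open>A\<close>.\<close>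

lemma indep_extend:
  assumes "indep E r I" "I \<subseteq> A" "A \<subseteq> E"
  obtains J where "I \<subseteq> J" "J \<subseteq> A" "indep E r J" "card J = r A"
proof -
  let ?S = "{J. I \<subseteq> J \<and> J \<subseteq> A \<and> indep E r J}"
  have "finite ?S" by (rule finite_subset[of _ "Pow A"]) (use finite_sub assms in auto)
  moreover have "I \<in> ?S" using assms by auto
  ultimately obtain J where J: "J \<in> ?S" and max: "\<forall>K\<in>?S. J \<subseteq> K \<longrightarrow> J = K"
    using finite_has_maximal2[of ?S I] by auto
  have JA: "J \<subseteq> A" and JE: "J \<subseteq> E" and rJ: "r J = card J" using J assms by (auto simp: indep_def)
  have fJ: "finite J" using JE finite_sub by blast
  have "r (insert e J) = r J" if "e \<in> A" for e
  proof (rule ccontr)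
    assume ne: "r (insert e J) \<noteq> r J"
    then have eJ: "e \<notin> J" by (metis insert_absorb)
    have sub: "insert e J \<subseteq> E" using that JE assms(3) by auto
    have "r J \<le> r (insert e J)" "r (insert e J) \<le> r J + 1"
      using rank_mono[of J "insert e J"] rank_insert_le sub by auto
    then have "indep E r (insert e J)" using ne rJ eJ fJ sub by (simp add: indep_def)
    then have "insert e J \<in> ?S" using J that by auto
    then have "J = insert e J" using max by (meson subset_insertI)
    then show False using eJ by blast
  qed
  then have "r (J \<union> A) = r J" using JE assms(3) by (intro rank_Un_eqI) auto
  then have "card J = r A" using JA rJ by (simp add: Un_absorb1)
  then show thesis using that J by blast
qed

lemma basis_iff: "basis E r B \<longleftrightarrow> indep E r B \<and> card B = r E"
proof
  assume B: "basis E r B"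
  then have ind: "indep E r B" and max: "\<forall>I. indep E r I \<and> B \<subseteq> I \<longrightarrow> I = B"
    unfolding basis_def by blast+
  have "B \<subseteq> E" using ind by (simp add: indep_def)
  then obtain J where J: "B \<subseteq> J" "indep E r J" "card J = r E"
    using indep_extend[OF ind _ order_refl] by metis
  have "J = B" using max J by blast
  then show "indep E r B \<and> card B = r E" using J by blast
next
  assume B: "indep E r B \<and> card B = r E"
  have "I = B" if "indep E r I" "B \<subseteq> I" for I
  proof -
    have "I \<subseteq> E" using that by (simp add: indep_def)
    then have "card I \<le> card B"
      using card_Int_le_rank[OF that(1), of E] B by (simp add: Int_absorb2)
    then show ?thesis using card_seteq[OF finite_sub[OF \<open>I \<subseteq> E\<close>] that(2)] by metis
  qed
  then show "basis E r B" using B unfolding basis_def by blast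
qed

text \<open>A basis of \<open>X\<close> is extended to one of \<open>Y\<close> and then to one of
  \<open>E\<close>. Independence bounds each intersection by the rank, so \<open>B\<close> stays
  tight on \<open>X\<close> and \<open>Y\<close>.\<close>

lemma exists_basis_chain:
  assumes "X \<subseteq> Y" "Y \<subseteq> E"
  obtains B where "basis E r B" "card (B \<inter> X) = r X" "card (B \<inter> Y) = r Y"
proof -
  have tight: "card (B \<inter> Z) = r Z"
    if "indep E r B" "J \<subseteq> B" "J \<subseteq> Z" "card J = r Z" "Z \<subseteq> E" for B J Z
  proof -
    have "finite B" using that finite_sub by (auto simp: indep_def)
    then have "card J \<le> card (B \<inter> Z)" using that by (intro card_mono) auto
    then show ?thesis using card_Int_le_rank[of B Z] that by simp
  qed
  have subs: "X \<subseteq> E" "{} \<subseteq> X" using assms by auto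
  have "indep E r {}" by (simp add: indep_def)
  then obtain J1 where J1: "J1 \<subseteq> X" "indep E r J1" "card J1 = r X"
    using indep_extend[OF _ subs(2,1)] by metis
  then obtain J2 where J2: "J1 \<subseteq> J2" "J2 \<subseteq> Y" "indep E r J2" "card J2 = r Y"
    using indep_extend[OF J1(2) _ assms(2)] assms(1) by (metis order_trans)
  then obtain B where B: "J2 \<subseteq> B" "indep E r B" "card B = r E"
    using indep_extend[OF J2(3) _ order_refl] assms(2) by (metis order_trans)
  show thesis
  proof
    show "basis E r B" using B basis_iff by simp
    show "card (B \<inter> X) = r X" by (rule tight[of B J1]) (use B J1 J2 assms in auto)
    show "card (B \<inter> Y) = r Y" by (rule tight[of B J2]) (use B J1 J2 assms in auto)
  qed
qed

section \<open>Separations of restrictions, duals and contractions\<close>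

lemma two_connectedD:
  assumes "two_connected F r" "F \<subseteq> E" "X \<noteq> {}" "X \<subset> F"
  shows "r F < r X + r (F - X)"
proof -
  have "r F \<noteq> r X + r (F - X)"
    using assms by (auto simp: two_connected_def disconnected_matroid_def)
  moreover have "X \<union> (F - X) = F" using assms by blast
  then have "r F \<le> r X + r (F - X)"
    using rank_subadditive[of X "F - X"] assms by auto
  ultimately show ?thesis by simp
qed

lemma rank_le_dual_sum: "X \<subseteq> E \<Longrightarrow> r E \<le> card X + r (E - X)"
  using rank_subadditive[of X "E - X"] rank_le_card[of X] by (simp add: Un_absorb1)

lemma dual_rank_add: "X \<subseteq> E \<Longrightarrow> dual_rank E r X + r E = card X + r (E - X)"
  using rank_le_dual_sum[of X] by (simp add: dual_rank_def)

text \<open>The right-hand side says that \<open>F \<union> X\<close> and \<open>E - X\<close>, with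
  union \<open>E\<close> and intersection \<open>F\<close>, form a modular pair. It recurs in
  \<open>contract_separation_iff\<close>, so that M/F and its dual M*|(E - F) have the same
  separations.\<close>

lemma dual_separation_iff:
  assumes "F \<subseteq> E" "X \<subseteq> E - F"
  shows "dual_rank E r (E - F) = dual_rank E r X + dual_rank E r (E - F - X) \<longleftrightarrow>
         r (F \<union> X) + r (E - X) = r E + r F"
proof -
  have "E - (E - F) = F" "E - (E - F - X) = F \<union> X" using assms by auto
  moreover have "card (E - F) = card X + card (E - F - X)"
    using card_eq_add_Diff[of "E - F" X] assms finite_ground by simp
  moreover have "X \<subseteq> E" "E - F - X \<subseteq> E" using assms by auto
  ultimately show ?thesis
    using dual_rank_add[of "E - F"] dual_rank_add[of X] dual_rank_add[of "E - F - X"] by auto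
qed

lemma contract_separation_iff:
  assumes "F \<subseteq> E" "X \<subseteq> E - F"
  shows "contract_rank r F (E - F) = contract_rank r F X + contract_rank r F (E - F - X) \<longleftrightarrow>
         r (F \<union> X) + r (E - X) = r E + r F"
proof -
  have "(E - F) \<union> F = E" "X \<union> F = F \<union> X" "(E - F - X) \<union> F = E - X" using assms by auto
  moreover have "r F \<le> r E" "r F \<le> r (F \<union> X)" "r F \<le> r (E - X)"
    using assms by (auto intro!: rank_mono)
  ultimately show ?thesis by (auto simp: contract_rank_def)
qed

lemma two_connected_dual_iff:
  assumes "F \<subseteq> E"
  shows "two_connected (E - F) (dual_rank E r) \<longleftrightarrow> two_connected (E - F) (contract_rank r F)"
  using dual_separation_iff[OF assms] contract_separation_iff[OF assms]
  by (simp add: two_connected_def disconnected_matroid_def psubset_eq cong: conj_cong)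

lemma contract_two_connectedD:
  assumes "two_connected (E - F) (contract_rank r F)" "F \<subseteq> E" "X \<noteq> {}" "X \<subset> E - F"
  shows "r (F \<union> X) + r (E - X) \<noteq> r E + r F"
  using assms contract_separation_iff[of F X]
  unfolding two_connected_def disconnected_matroid_def by blast

text \<open>Passing from \<open>E - Y\<close> to \<open>E - X\<close> adds
  \<open>card (Y - X)\<close> elements, hence at most that much rank; the cardinality term of the
  dual rank compensates.\<close>

lemma dual_rank_mono:
  assumes "X \<subseteq> Y" "Y \<subseteq> E"
  shows "dual_rank E r X \<le> dual_rank E r Y"
proof -
  have "(E - Y) \<union> (Y - X) = E - X" using assms by auto
  then have "r (E - X) \<le> r (E - Y) + r (Y - X)" using assms by (metis Diff_subset order.trans rank_subadditive)
  moreover have "r (Y - X) \<le> card (Y - X)" using assms by (intro rank_le_card) auto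
  moreover have "card Y = card X + card (Y - X)"
    using card_eq_add_Diff[of Y X] assms finite_sub by simp
  ultimately show ?thesis
    using dual_rank_add[of X] dual_rank_add[of Y] assms by (simp add: order_trans)
qed

section \<open>Essential closures and locked subsets are flacets\<close>

text \<open>Connectedness of M/P is part of the definition. For M|P, every nonempty subset of
  \<open>P\<close> has rank at least 1, so the two sides of a separation would have rank sum at
  least 2.\<close>

lemma essential_parallel_flacet:
  assumes "P \<in> essential_parallel_closures E r"
  shows "flacet E r P"
proof -
  have P: "P \<subseteq> E" "r P = 1" "\<And>e. e \<in> P \<Longrightarrow> r {e} = 1"
    and con: "two_connected (E - P) (contract_rank r P)"
    using assms by (auto simp: essential_parallel_closures_def parallel_closure_def)
  have pos: "r X \<ge> 1" if X: "X \<noteq> {}" "X \<subseteq> P" for X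
  proof -
    obtain e where e: "e \<in> X" using X by blast
    then have "r {e} \<le> r X" using X P by (intro rank_mono) auto
    moreover have "r {e} = 1" using e X P by blast
    ultimately show ?thesis by simp
  qed
  have "r P \<noteq> r X + r (P - X)" if X: "X \<noteq> {}" "X \<subset> P" for X
  proof -
    have "1 \<le> r X" "1 \<le> r (P - X)" using X by (blast intro: pos)+
    then show ?thesis using P(2) by simp
  qed
  moreover have "P \<noteq> {}" using P by auto
  ultimately have "two_connected P r"
    by (auto simp: two_connected_def disconnected_matroid_def)
  then show ?thesis using con P(1) by (auto simp: flacet_def two_connected_def)
qed

text \<open>The same argument in the dual shows that M*|(E - F) is connected, which
  \<open>two_connected_dual_iff\<close> transfers to M/F.\<close>

lemma essential_coparallel_flacet:
  assumes "E - F \<in> essential_coparallel_closures E r" "F \<subseteq> E"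
  shows "flacet E r F"
proof -
  let ?S = "E - F"
  have EF: "E - ?S = F" using assms(2) by auto
  have S: "dual_rank E r ?S = 1" "\<And>e. e \<in> ?S \<Longrightarrow> dual_rank E r {e} = 1"
    and con: "two_connected F r"
    using assms EF
    by (auto simp: essential_coparallel_closures_def coparallel_closure_def parallel_closure_def)
  have pos: "dual_rank E r X \<ge> 1" if X: "X \<noteq> {}" "X \<subseteq> ?S" for X
  proof -
    obtain e where e: "e \<in> X" using X by blast
    then have "dual_rank E r {e} \<le> dual_rank E r X" using X by (intro dual_rank_mono) auto
    moreover have "dual_rank E r {e} = 1" using e X S by blast
    ultimately show ?thesis by simp
  qed
  have "dual_rank E r ?S \<noteq> dual_rank E r X + dual_rank E r (?S - X)" if X: "X \<noteq> {}" "X \<subset> ?S" for X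
  proof -
    have "1 \<le> dual_rank E r X" "1 \<le> dual_rank E r (?S - X)" using X by (blast intro: pos)+
    then show ?thesis using S(1) by simp
  qed
  moreover have "?S \<noteq> {}" using S(1) dual_rank_add[of "{}"] by (metis add_cancel_left_left card.empty Diff_empty empty_subsetI zero_neq_one)
  ultimately have "two_connected ?S (dual_rank E r)"
    by (auto simp: two_connected_def disconnected_matroid_def)
  then show ?thesis using con two_connected_dual_iff[OF assms(2)] \<open>?S \<noteq> {}\<close> assms(2)
    by (auto simp: flacet_def)
qed

lemma locked_flacet: "L \<in> locked_subsets E r \<Longrightarrow> flacet E r L"
  using two_connected_dual_iff[of L] by (auto simp: locked_subsets_def flacet_def)

section \<open>The greedy algorithm\<close>

text \<open>The inequality for the threshold \<open>m\<close> is the Abel summation that certifies the optimality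
  of \<open>I\<close>, in a form that survives inserting elements in order of decreasing weight.\<close>

lemma greedy:
  fixes a :: "'a \<Rightarrow> real"
  assumes "finite S" "S \<subseteq> E"
  shows "\<exists>I\<subseteq>S. indep E r I \<and> card I = r S \<and>
    (\<forall>(x::'a \<Rightarrow> real) (m::real). (\<forall>F\<subseteq>S. sum x F \<le> r F) \<longrightarrow> (\<forall>e\<in>S. m \<le> a e) \<longrightarrow>
      (\<Sum>e\<in>S. a e * x e) - m * sum x S \<le> sum a I - m * r S)"
  using assms
\<comment> \<open>The inserted element has the largest \<open>- a e\<close>, so it is the lightest
  so far.\<close>
proof (induction S rule: finite_ranking_induct[where f = "\<lambda>e. - a e"])
  case empty
  have "indep E r {}" by (simp add: indep_def)
  then show ?case by auto
next
  case (insert e S)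
  let ?S = "insert e S"
  show ?case
  proof (cases "e \<in> S")
    case True
    then show ?thesis using insert.IH insert.prems by (simp add: insert_absorb)
  next
    case False
    obtain I where I: "I \<subseteq> S" "indep E r I" "card I = r S"
      and opt: "\<And>(x::'a \<Rightarrow> real) (m::real). (\<forall>F\<subseteq>S. sum x F \<le> r F) \<Longrightarrow> (\<forall>e\<in>S. m \<le> a e) \<Longrightarrow>
        (\<Sum>e\<in>S. a e * x e) - m * sum x S \<le> sum a I - m * r S"
      using insert.IH insert.prems by auto
    have "I \<subseteq> ?S" using I(1) by auto
    then obtain J where J: "I \<subseteq> J" "J \<subseteq> ?S" "indep E r J" "card J = r ?S"
      using indep_extend[OF I(2) _ insert.prems] by metis
    have finJ: "finite J" using J(2) insert.hyps(1) finite_subset by blast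
    \<comment> \<open>\<open>I\<close> already has the largest size possible in \<open>S\<close>, so
      \<open>J\<close> gains at most the new element.\<close>
    have "J \<inter> S = I"
    proof -
      have "card (J \<inter> S) \<le> card I"
        using card_Int_le_rank[OF J(3), of S] insert.prems I(3) by simp
      then show ?thesis using card_seteq[of "J \<inter> S" I] I J finJ by auto
    qed
    then consider "J = I" | "J = insert e I" "e \<notin> I" using J(1,2) False I(1) by blast
    then have sumJ: "sum a J = sum a I + a e * (real (r ?S) - real (r S))"
    proof cases
      case 1
      then show ?thesis using J I by simp
    next
      case 2
      then have "finite I" using finJ by simp
      then have "card J = card I + 1" "sum a J = sum a I + a e" using 2 by simp_all
      then have "real (r ?S) - real (r S) = 1" using J I by simp
      then show ?thesis using \<open>sum a J = sum a I + a e\<close> by simp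
    qed
    have "(\<Sum>e\<in>?S. a e * x e) - m * sum x ?S \<le> sum a J - m * r ?S"
      if x: "\<forall>F\<subseteq>?S. sum x F \<le> r F" and m: "\<forall>e\<in>?S. m \<le> a e" for x :: "'a \<Rightarrow> real" and m :: real
    proof -
      \<comment> \<open>The induction hypothesis is used with threshold \<open>a e\<close>,
        admissible because \<open>e\<close> is lightest; the next inequality lowers the threshold to
        \<open>m\<close>.\<close>
      have "(\<Sum>e\<in>S. a e * x e) - a e * sum x S \<le> sum a I - a e * r S"
        using x insert.hyps(2) by (intro opt) auto
      moreover have "(a e - m) * sum x ?S \<le> (a e - m) * r ?S"
        using x m by (intro mult_left_mono) auto
      moreover have "(\<Sum>e\<in>?S. a e * x e) = (\<Sum>e\<in>S. a e * x e) + a e * x e"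
        "sum x ?S = sum x S + x e"
        using False insert.hyps(1) by auto
      ultimately show ?thesis unfolding sumJ by (simp add: algebra_simps)
    qed
    then show ?thesis using J by blast
  qed
qed

text \<open>For \<open>sum x E = r E\<close> the two threshold terms of \<open>greedy\<close>
  cancel, so any lower bound of the weights serves as \<open>m\<close>.\<close>

lemma exists_optimal_basis:
  fixes a :: "'a \<Rightarrow> real"
  shows "\<exists>B. basis E r B \<and> (\<forall>x::'a \<Rightarrow> real. sum x E = r E \<longrightarrow> (\<forall>F\<subseteq>E. sum x F \<le> r F) \<longrightarrow>
    (\<Sum>e\<in>E. a e * x e) \<le> sum a B)"
proof -
  obtain B where B: "indep E r B" "card B = r E"
    and opt: "\<And>(x::'a \<Rightarrow> real) (m::real). (\<forall>F\<subseteq>E. sum x F \<le> r F) \<Longrightarrow> (\<forall>e\<in>E. m \<le> a e) \<Longrightarrow>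
      (\<Sum>e\<in>E. a e * x e) - m * sum x E \<le> sum a B - m * r E"
    using greedy[OF finite_ground order_refl, of a] by auto
  \<comment> \<open>The inserted 0 keeps the argument of \<open>Min\<close> nonempty when
    \<open>E\<close> is empty.\<close>
  have "\<forall>e\<in>E. Min (insert 0 (a ` E)) \<le> a e" using finite_ground by auto
  note bound = opt[OF _ this]
  have "(\<Sum>e\<in>E. a e * x e) \<le> sum a B"
    if "sum x E = r E" "\<forall>F\<subseteq>E. sum x F \<le> r F" for x :: "'a \<Rightarrow> real"
    using bound[OF that(2)] unfolding that(1) by simp
  then show ?thesis using B basis_iff by blast
qed

end

section \<open>Classification of the flacets of a connected matroid\<close>

locale connected_matroid = matroid_rank +
  assumes connected: "two_connected E r"
begin

text \<open>A loop would split off as a separation; \<open>rank_delete_singleton\<close> is the same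
  for coloops.\<close>

lemma rank_singleton_eq_1:
  assumes "e \<in> E" "E \<noteq> {e}"
  shows "r {e} = 1"
proof -
  have "r E < r {e} + r (E - {e})"
    using assms by (intro two_connectedD connected) auto
  moreover have "r (E - {e}) \<le> r E" by (rule rank_mono) auto
  moreover have "r {e} \<le> 1" using rank_le_card[of "{e}"] assms by simp
  ultimately show ?thesis by simp
qed

lemma rank_delete_singleton:
  assumes "e \<in> E" "E \<noteq> {e}"
  shows "r (E - {e}) = r E"
proof -
  have "r E < r {e} + r (E - {e})"
    using assms by (intro two_connectedD connected) auto
  moreover have "r (E - {e}) \<le> r E" by (rule rank_mono) auto
  ultimately show ?thesis using rank_singleton_eq_1[OF assms] by simp
qed

lemma dual_rank_singleton:
  assumes "e \<in> E" "E \<noteq> {e}"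
  shows "dual_rank E r {e} = 1"
  using dual_rank_add[of "{e}"] rank_delete_singleton[OF assms] assms(1) by simp

text \<open>A point \<open>e\<close> by which \<open>F\<close> could grow in rank 1 is a loop of
  M/F. A loop separates M/F unless it is the only element, which \<open>two\<close>
  excludes.\<close>

lemma parallel_flacet_essential:
  assumes F: "flacet E r F" and "r F = 1" and two: "card (E - F) \<noteq> 1"
  shows "F \<in> essential_parallel_closures E r"
proof -
  have FE: "F \<subset> E" and F0: "F \<noteq> {}" and con: "two_connected (E - F) (contract_rank r F)"
    using F by (auto simp: flacet_def two_connected_def)
  have ne: "E \<noteq> {e}" for e using FE F0 by auto
  have "Q = F" if Q: "F \<subseteq> Q" "Q \<subseteq> E" "r Q = 1" for Q
  proof (rule ccontr)
    assume "Q \<noteq> F"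
    then obtain e where e: "e \<in> Q" "e \<notin> F" using Q by blast
    have "r F \<le> r (F \<union> {e})" "r (F \<union> {e}) \<le> r Q"
      using e Q rank_mono[of F "F \<union> {e}"] rank_mono[of "F \<union> {e}" Q] by auto
    then have "r (F \<union> {e}) + r (E - {e}) = r E + r F"
      using Q assms(2) rank_delete_singleton[of e] ne e by auto
    moreover have "{e} \<subset> E - F"
      using e Q two by (metis Diff_iff empty_subsetI insert_subset is_singletonI is_singleton_altdef psubsetI subsetD)
    ultimately show False using contract_two_connectedD[OF con] FE by blast
  qed
  then have "parallel_closure E r F"
    using assms(2) FE rank_singleton_eq_1 ne by (auto simp: parallel_closure_def)
  then show ?thesis using con by (simp add: essential_parallel_closures_def)
qed

text \<open>Dually, a point \<open>e\<close> by which \<open>E - F\<close> could grow is a coloop of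
  M|F, and \<open>two\<close> makes \<open>{e}\<close> a proper part of \<open>F\<close>.\<close>

lemma coparallel_flacet_essential:
  assumes F: "flacet E r F" and "dual_rank E r (E - F) = 1" and two: "card F \<noteq> 1"
  shows "E - F \<in> essential_coparallel_closures E r"
proof -
  have FE: "F \<subset> E" and F0: "F \<noteq> {}" and con: "two_connected F r"
    using F by (auto simp: flacet_def two_connected_def)
  have ne: "E \<noteq> {e}" for e using FE F0 by auto
  have EF: "E - (E - F) = F" using FE by auto
  have "Q = E - F" if Q: "E - F \<subseteq> Q" "Q \<subseteq> E" "dual_rank E r Q = 1" for Q
  proof (rule ccontr)
    assume "Q \<noteq> E - F"
    then obtain e where e: "e \<in> Q" "e \<in> F" using Q by blast
    have "dual_rank E r (E - F) \<le> dual_rank E r (insert e (E - F))"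
      "dual_rank E r (insert e (E - F)) \<le> dual_rank E r Q"
      using e Q dual_rank_mono[of "E - F" "insert e (E - F)"]
        dual_rank_mono[of "insert e (E - F)" Q] by auto
    then have "dual_rank E r (insert e (E - F)) = 1"
      using Q assms(2) by simp
    moreover have "E - insert e (E - F) = F - {e}" using FE by auto
    moreover have "card (insert e (E - F)) = card (E - F) + 1"
      using e finite_ground by simp
    ultimately have "r F = r (F - {e}) + 1"
      using dual_rank_add[of "E - F"] dual_rank_add[of "insert e (E - F)"] e Q assms(2) EF
      by auto
    moreover have "{e} \<subset> F" using e two by (auto simp: psubset_eq)
    then have "r F < r {e} + r (F - {e})" using con FE by (intro two_connectedD) auto
    ultimately show False using rank_singleton_eq_1[of e] ne e FE by auto
  qed
  then have "coparallel_closure E r (E - F)"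
    using assms(2) FE dual_rank_singleton ne
    by (auto simp: coparallel_closure_def parallel_closure_def)
  then show ?thesis using con EF by (simp add: essential_coparallel_closures_def)
qed

lemma flacet_rank_pos:
  assumes "flacet E r F"
  shows "r F \<ge> 1" "dual_rank E r (E - F) \<ge> 1"
proof -
  have FE: "F \<subset> E" and F0: "F \<noteq> {}"
    using assms by (auto simp: flacet_def two_connected_def)
  have ne: "E \<noteq> {e}" for e using FE F0 by auto
  obtain e f where "e \<in> F" "f \<in> E - F" using FE F0 by blast
  then have "r {e} \<le> r F" "dual_rank E r {f} \<le> dual_rank E r (E - F)"
    using FE by (auto intro!: rank_mono dual_rank_mono)
  moreover have "r {e} = 1" "dual_rank E r {f} = 1"
    using \<open>e \<in> F\<close> \<open>f \<in> E - F\<close> FE ne rank_singleton_eq_1 dual_rank_singleton by blast+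
  ultimately show "r F \<ge> 1" "dual_rank E r (E - F) \<ge> 1" by simp_all
qed

lemma flacet_iff:
  assumes "card E \<noteq> 2" and "F \<subseteq> E"
  shows "flacet E r F \<longleftrightarrow> F \<in> essential_parallel_closures E r \<or>
    E - F \<in> essential_coparallel_closures E r \<or> F \<in> locked_subsets E r"
proof
  assume F: "flacet E r F"
  have FE: "F \<subset> E" using F by (auto simp: flacet_def)
  have EF: "E - (E - F) = F" using FE by auto
  note pos = flacet_rank_pos[OF F]
  have cards: "card F + card (E - F) = card E"
    using card_eq_add_Diff[of E F] FE finite_ground by auto
  have dual: "dual_rank E r (E - F) + r E = card (E - F) + r F"
    using dual_rank_add[of "E - F"] EF by simp
  consider "r F = 1" "card (E - F) \<noteq> 1" | "r F = 1" "card (E - F) = 1"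
    | "r F \<ge> 2" "dual_rank E r (E - F) = 1" | "r F \<ge> 2" "dual_rank E r (E - F) \<ge> 2"
    using pos by linarith
  then show "F \<in> essential_parallel_closures E r \<or>
    E - F \<in> essential_coparallel_closures E r \<or> F \<in> locked_subsets E r"
  proof cases
    case 1
    then show ?thesis using parallel_flacet_essential F by blast
  next
    case 2
    \<comment> \<open>Here all of \<open>E\<close> is one parallel class, so \<open>F\<close> is not
      a parallel closure. The dual rank of \<open>E - F\<close> is 1 as well, and \<open>F\<close>
      is classified through its complement; \<open>card E \<noteq> 2\<close> keeps \<open>F\<close>
      from being a single point.\<close>
    have "r F \<le> r E" using FE by (intro rank_mono) auto
    then have "dual_rank E r (E - F) = 1" using pos 2 dual by linarith
    moreover have "card F \<noteq> 1" using cards 2 assms(1) by linarith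
    ultimately show ?thesis using coparallel_flacet_essential F by blast
  next
    case 3
    then have "card F \<noteq> 1" using rank_le_card[of F] FE by auto
    then show ?thesis using coparallel_flacet_essential F 3 by blast
  next
    case 4
    then have "F \<in> locked_subsets E r"
      using F two_connected_dual_iff[of F] FE by (auto simp: flacet_def locked_subsets_def)
    then show ?thesis by blast
  qed
qed (use assms(2) essential_parallel_flacet essential_coparallel_flacet locked_flacet in blast)

section \<open>The flacet constraints imply all rank constraints\<close>

text \<open>By uncrossing, a separation of M|(F \<union> X) restricts to \<open>F\<close>, which is
  connected, so one side \<open>Z\<close> lies in \<open>X\<close>. The modular pair in
  \<open>sep\<close> then makes \<open>Z\<close> a separator of M, against connectedness.\<close>

lemma two_connected_enlarge:
  assumes F: "two_connected F r" "F \<subseteq> E" and X: "X \<subseteq> E - F"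
    and sep: "r (F \<union> X) + r (E - X) = r E + r F"
  shows "two_connected (F \<union> X) r"
proof -
  let ?A = "F \<union> X"
  have F0: "F \<noteq> {}" using F by (simp add: two_connected_def)
  have AE: "?A \<subseteq> E" using F X by auto
  have no_split: False if Z: "Z \<noteq> {}" "Z \<subseteq> X" "r ?A = r Z + r (?A - Z)" for Z
  proof -
    have "r ((?A - Z) \<union> (E - X)) + r ((?A - Z) \<inter> (E - X)) \<le> r (?A - Z) + r (E - X)"
      using AE by (intro rank_submodular) auto
    moreover have "(?A - Z) \<union> (E - X) = E - Z" "(?A - Z) \<inter> (E - X) = F"
      using F X Z by auto
    ultimately have "r Z + r (E - Z) \<le> r E" using sep Z(3) by simp
    moreover have "r E < r Z + r (E - Z)"
      using Z X F F0 by (intro two_connectedD[OF connected]) auto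
    ultimately show False by simp
  qed
  have "r ?A \<noteq> r Y + r (?A - Y)" if Y: "Y \<noteq> {}" "Y \<subset> ?A" for Y
  proof
    assume eq: "r ?A = r Y + r (?A - Y)"
    \<comment> \<open>The two submodular inequalities share \<open>r (F \<union> Y)\<close>; their
      sum bounds the ranks of \<open>F \<inter> Y\<close> and \<open>F - F \<inter> Y\<close>
      together by \<open>r F\<close>.\<close>
    have "r (F \<union> Y) + r (F \<inter> Y) \<le> r F + r Y"
      using AE Y F by (intro rank_submodular) auto
    moreover have "r ((F \<union> Y) \<union> (?A - Y)) + r ((F \<union> Y) \<inter> (?A - Y)) \<le> r (F \<union> Y) + r (?A - Y)"
      using AE Y F by (intro rank_submodular) auto
    moreover have "(F \<union> Y) \<union> (?A - Y) = ?A" "(F \<union> Y) \<inter> (?A - Y) = F - F \<inter> Y"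
      using Y by auto
    ultimately have "r (F \<inter> Y) + r (F - F \<inter> Y) \<le> r F" using eq by simp
    then have "\<not> (F \<inter> Y \<noteq> {} \<and> F \<inter> Y \<subset> F)"
      using two_connectedD[OF F, of "F \<inter> Y"] by auto
    then consider "F \<inter> Y = {}" | "F \<subseteq> Y" by blast
    then show False
    proof cases
      case 1
      then have "Y \<subseteq> X" using Y by auto
      then show False using no_split[OF Y(1)] eq by simp
    next
      case 2
      have "?A - (?A - Y) = Y" using Y by auto
      moreover have "?A - Y \<noteq> {}" "?A - Y \<subseteq> X" using 2 Y by auto
      ultimately show False using no_split[of "?A - Y"] eq by simp
    qed
  qed
  then show ?thesis using F0 by (auto simp: two_connected_def disconnected_matroid_def)
qed

text \<open>If M/F splits into \<open>X\<close> and \<open>X'\<close>, the slack of \<open>F\<close>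
  is the sum of the slacks of \<open>F \<union> X\<close> and \<open>F \<union> X' = E - X\<close>.
  Both sets are larger and connected by \<open>two_connected_enlarge\<close>, so the induction ends
  at \<open>E\<close> or at flacets.\<close>

lemma flacets_suffice_connected:
  fixes x :: "'a \<Rightarrow> real"
  assumes total: "sum x E = r E"
    and flacets: "\<And>F. flacet E r F \<Longrightarrow> sum x F \<le> r F"
  shows "two_connected F r \<Longrightarrow> F \<subseteq> E \<Longrightarrow> sum x F \<le> r F"
proof (induction "card (E - F)" arbitrary: F rule: less_induct)
  case less
  note FE = \<open>F \<subseteq> E\<close> and con = \<open>two_connected F r\<close>
  show ?case
  proof (cases "F = E \<or> flacet E r F")
    case True
    then show ?thesis using total flacets by auto
  next
    case False
    then have "\<not> two_connected (E - F) (contract_rank r F)" "E - F \<noteq> {}"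
      using FE con by (auto simp: flacet_def)
    then obtain X where X: "X \<noteq> {}" "X \<subset> E - F"
      and "contract_rank r F (E - F) = contract_rank r F X + contract_rank r F (E - F - X)"
      by (auto simp: two_connected_def disconnected_matroid_def)
    then have sep: "r (F \<union> X) + r (E - X) = r E + r F"
      using contract_separation_iff[of F X] FE by auto
    define X' where "X' = E - F - X"
    have X': "X' \<noteq> {}" "X' \<subseteq> E - F" "F \<union> X' = E - X" "E - X' = F \<union> X"
      using X FE by (auto simp: X'_def)
    have smaller: "card (E - (F \<union> Y)) < card (E - F)" if "Y \<noteq> {}" "Y \<subseteq> E - F" for Y
      using that finite_ground by (intro psubset_card_mono) auto
    have "two_connected (F \<union> X) r"
      using con FE X sep by (intro two_connected_enlarge) auto
    then have 1: "sum x (F \<union> X) \<le> r (F \<union> X)"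
      using less.hyps[of "F \<union> X"] smaller[of X] X FE by auto
    have "two_connected (F \<union> X') r"
      using con FE X' sep by (intro two_connected_enlarge) auto
    then have 2: "sum x (E - X) \<le> r (E - X)"
      using less.hyps[of "F \<union> X'"] smaller[of X'] X' FE by auto
    have "sum x ((F \<union> X) \<union> (E - X)) + sum x ((F \<union> X) \<inter> (E - X)) = sum x (F \<union> X) + sum x (E - X)"
      using X FE finite_sub by (intro sum.union_inter) auto
    moreover have "(F \<union> X) \<union> (E - X) = E" "(F \<union> X) \<inter> (E - X) = F" using X FE by auto
    ultimately have "r E + sum x F = sum x (F \<union> X) + sum x (E - X)" using total by simp
    moreover have "real (r (F \<union> X)) + real (r (E - X)) = real (r E) + real (r F)"
      using sep by (metis of_nat_add)
    ultimately show ?thesis using 1 2 by linarith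
  qed
qed

text \<open>The slack of a disconnected \<open>F\<close> is the sum of the slacks of its two parts,
  which reduces the claim to connected sets.\<close>

lemma flacets_suffice:
  fixes x :: "'a \<Rightarrow> real"
  assumes "sum x E = r E"
    and "\<And>F. flacet E r F \<Longrightarrow> sum x F \<le> r F"
  shows "F \<subseteq> E \<Longrightarrow> sum x F \<le> r F"
proof (induction "card F" arbitrary: F rule: less_induct)
  case less
  show ?case
  proof (cases "F = {} \<or> two_connected F r")
    case True
    then show ?thesis using flacets_suffice_connected[OF assms] less.prems by auto
  next
    case False
    then obtain X where X: "X \<noteq> {}" "X \<subset> F" "r F = r X + r (F - X)"
      by (auto simp: two_connected_def disconnected_matroid_def)
    have fin: "finite F" using less.prems finite_sub by blast
    have "sum x X \<le> r X"
      using X less fin by (intro less.hyps psubset_card_mono) auto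
    moreover have "sum x (F - X) \<le> r (F - X)"
      using X less fin by (intro less.hyps psubset_card_mono) auto
    moreover have "sum x F = sum x (F - X) + sum x X"
      using X fin by (intro sum.subset_diff) auto
    ultimately show ?thesis using X(3) by simp
  qed
qed

section \<open>Tight bases\<close>

text \<open>A basis tight on \<open>E - X\<close> has only \<open>r E - r (E - X)\<close> points in
  \<open>X\<close>, fewer than \<open>r X\<close> by connectedness.\<close>

lemma exists_nontight_basis:
  assumes "X \<noteq> {}" "X \<subset> E"
  shows "\<exists>B. basis E r B \<and> card (B \<inter> X) < r X"
proof -
  obtain B where B: "basis E r B" "card (B \<inter> (E - X)) = r (E - X)"
    using exists_basis_chain[OF Diff_subset order_refl] by metis
  have "B \<subseteq> E" "card B = r E" using B(1) by (auto simp: basis_iff indep_def)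
  moreover have "B - B \<inter> X = B \<inter> (E - X)" using \<open>B \<subseteq> E\<close> by auto
  ultimately have "r E = card (B \<inter> X) + r (E - X)"
    using card_eq_add_Diff[of B "B \<inter> X"] finite_sub[of B] B by simp
  moreover have "r E < r X + r (E - X)"
    using assms by (intro two_connectedD[OF connected]) auto
  ultimately show ?thesis using B by auto
qed

text \<open>Bases tight on \<open>F\<close> are also tight on \<open>F \<inter> G\<close> and
  \<open>F \<union> G\<close>. Connectedness of M|F leaves \<open>{}\<close> or \<open>F\<close> for
  the intersection, that of M/F leaves \<open>F\<close> or \<open>E\<close> for the union, and that
  of M rules out \<open>G = E - F\<close>.\<close>

lemma flacet_determined_by_tight_bases:
  assumes F: "flacet E r F" and G: "G \<subseteq> E" "G \<noteq> {}" "G \<noteq> E"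
    and tight: "\<And>B. basis E r B \<Longrightarrow> card (B \<inter> F) = r F \<Longrightarrow> card (B \<inter> G) = r G"
  shows "G = F"
proof -
  have FE: "F \<subset> E" and F0: "F \<noteq> {}" and con: "two_connected F r"
    and ccon: "two_connected (E - F) (contract_rank r F)"
    using F by (auto simp: flacet_def two_connected_def)
  have split: "card (B \<inter> Y) = card (B \<inter> X) + card (B \<inter> (Y - X))"
    if "basis E r B" "X \<subseteq> Y" for B X Y
  proof -
    have "finite B" using that finite_sub by (simp add: basis_iff indep_def)
    moreover have "B \<inter> Y = (B \<inter> X) \<union> (B \<inter> (Y - X))" using that(2) by auto
    ultimately show ?thesis using card_Un_disjoint[of "B \<inter> X" "B \<inter> (Y - X)"] by fastforce
  qed
  have le: "card (B \<inter> X) \<le> r X" if "basis E r B" "X \<subseteq> E" for B X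
    using that card_Int_le_rank by (auto simp: basis_iff)
  have full: "card (B \<inter> E) = r E" if "basis E r B" for B
    using that by (auto simp: basis_iff indep_def Int_absorb2)
  \<comment> \<open>Cardinalities are modular and ranks submodular, so tightness on \<open>F\<close>
    and \<open>G\<close> passes to their intersection and union.\<close>
  have lattice: "card (B \<inter> (F \<inter> G)) = r (F \<inter> G) \<and> card (B \<inter> (F \<union> G)) = r (F \<union> G)"
    if B: "basis E r B" "card (B \<inter> F) = r F" for B
  proof -
    have "r (F \<union> G) + r (F \<inter> G) \<le> r F + r G" using FE G by (intro rank_submodular) auto
    moreover have "card (B \<inter> (F \<inter> G)) \<le> r (F \<inter> G)" "card (B \<inter> (F \<union> G)) \<le> r (F \<union> G)"
      using B FE G by (auto intro!: le)
    moreover have "card (B \<inter> F) = card (B \<inter> (F \<inter> G)) + card (B \<inter> (F - G))"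
      using split[OF B(1), of "F \<inter> G" F] by (simp add: Diff_Int)
    moreover have "card (B \<inter> (F \<union> G)) = card (B \<inter> G) + card (B \<inter> (F - G))"
      using split[OF B(1), of G "F \<union> G"] by (simp add: Un_Diff)
    ultimately show ?thesis using B(2) tight[OF B] by linarith
  qed
  have "F \<inter> G = {} \<or> F \<inter> G = F"
  proof (rule ccontr)
    assume neg: "\<not> (F \<inter> G = {} \<or> F \<inter> G = F)"
    \<comment> \<open>Such a basis is also tight on \<open>F \<inter> G\<close>, so the ranks of the
      two pieces would add up to \<open>r F\<close>.\<close>
    obtain B where B: "basis E r B" "card (B \<inter> (F - F \<inter> G)) = r (F - F \<inter> G)" "card (B \<inter> F) = r F"
      using exists_basis_chain[OF Diff_subset] FE by (metis psubset_imp_subset)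
    have "card (B \<inter> F) = card (B \<inter> (F \<inter> G)) + card (B \<inter> (F - F \<inter> G))"
      using split[OF B(1), of "F \<inter> G" F] by blast
    moreover have "r F < r (F \<inter> G) + r (F - F \<inter> G)"
      using neg FE by (intro two_connectedD con) auto
    ultimately show False using lattice[OF B(1,3)] B(2,3) by linarith
  qed
  moreover have "F \<union> G = F \<or> F \<union> G = E"
  proof (rule ccontr)
    assume neg: "\<not> (F \<union> G = F \<or> F \<union> G = E)"
    let ?X = "G - F"
    have X: "?X \<noteq> {}" "?X \<subset> E - F" using neg G FE by auto
    \<comment> \<open>A basis tight on \<open>F\<close> and on \<open>E - ?X\<close> is also tight
      on \<open>F \<union> G\<close>; counting its elements makes \<open>?X\<close> a separator of
      M/F.\<close>
    have "F \<subseteq> E - ?X" using FE by auto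
    then obtain B where B: "basis E r B" "card (B \<inter> F) = r F"
      "card (B \<inter> (E - ?X)) = r (E - ?X)"
      using exists_basis_chain[OF _ Diff_subset] by metis
    have "card (B \<inter> E) = card (B \<inter> ?X) + card (B \<inter> (E - ?X))"
      using split[OF B(1), of ?X E] G(1) by blast
    moreover have "card (B \<inter> (F \<union> G)) = card (B \<inter> F) + card (B \<inter> ?X)"
      using split[OF B(1), of F "F \<union> G"] by (simp add: Un_Diff)
    ultimately have "r (F \<union> G) + r (E - ?X) = r E + r F"
      using lattice[OF B(1,2)] B(2,3) full[OF B(1)] by linarith
    then have "r (F \<union> ?X) + r (E - ?X) = r E + r F" by simp
    then show False using contract_two_connectedD[OF ccon _ X] FE by blast
  qed
  moreover have "G = E - F \<Longrightarrow> False"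
  proof -
    assume G: "G = E - F"
    obtain B where B: "basis E r B" "card (B \<inter> F) = r F"
      using exists_basis_chain[OF psubset_imp_subset[OF FE] order_refl] by metis
    have "card (B \<inter> E) = card (B \<inter> F) + card (B \<inter> (E - F))"
      using split[OF B(1), of F E] FE by blast
    then have "r E = r F + r (E - F)"
      using B(2) tight[OF B] full[OF B(1)] unfolding G by linarith
    moreover have "r E < r F + r (E - F)" using FE F0 by (intro two_connectedD connected) auto
    ultimately show False by simp
  qed
  ultimately show ?thesis using G by blast
qed

end

section \<open>Coordinate sums and the polytope as a solution set\<close>

lemma vsum_add: "vsum (x + y) F = vsum x F + vsum y F"
  by (simp add: vsum_def sum.distrib)

lemma vsum_scaleR: "vsum (c *\<^sub>R x) F = c * vsum x F"
  by (simp add: vsum_def sum_distrib_left)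

lemma vsum_sum: "vsum (\<Sum>i\<in>A. f i) F = (\<Sum>i\<in>A. vsum (f i) F)"
  unfolding vsum_def sum_component by (rule sum.swap)

lemma vsum_char_vec: "vsum (char_vec B) F = card (B \<inter> F)"
proof -
  have "vsum (char_vec B) F = (\<Sum>e\<in>F. if e \<in> B then 1 else 0)"
    by (simp add: vsum_def char_vec_def)
  also have "\<dots> = card (F \<inter> B)"
    by (simp add: sum.inter_restrict[symmetric])
  finally show ?thesis by (simp add: Int_commute)
qed

lemma vsum_Compl: "vsum x (UNIV - F) = vsum x UNIV - vsum x F"
  using sum.subset_diff[of F UNIV "\<lambda>e. x $ e"] by (simp add: vsum_def)

lemma continuous_on_vsum [continuous_intros]: "continuous_on A (\<lambda>x. vsum x F)"
  unfolding vsum_def by (intro continuous_intros)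

lemma inner_vec_eq_sum: "inner a x = (\<Sum>e\<in>UNIV. a $ e * x $ e)" for a x :: "real ^ 'e::finite"
  by (simp add: inner_vec_def)

text \<open>The right-hand side is convex and contains the characteristic vectors of the bases.
  Conversely, a linear functional separating a point from the hull would contradict the optimality
  of a greedy basis.\<close>

lemma bases_polytope_eq:
  fixes r :: "'e::finite set \<Rightarrow> nat"
  assumes "matroid UNIV r"
  shows "bases_polytope r = {x. vsum x UNIV = r UNIV \<and> (\<forall>F. vsum x F \<le> r F)}" (is "_ = ?Q")
proof
  interpret matroid_rank UNIV r by unfold_locales (rule assms)
  let ?V = "char_vec ` {B. basis UNIV r B}"
  have "linear (\<lambda>x::real ^ 'e. vsum x F)" for F
    by (auto intro!: linearI simp: vsum_add vsum_scaleR)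
  then have "convex ((\<lambda>x::real ^ 'e. vsum x F) -` S)" if "convex S" for F S
    using that by (intro convex_linear_vimage)
  then have "convex ((\<lambda>x::real ^ 'e. vsum x UNIV) -` {real (r UNIV)} \<inter>
      (\<Inter>F. (\<lambda>x. vsum x F) -` {..real (r F)}))"
    by (intro convex_Int convex_INT) auto
  also have "(\<lambda>x::real ^ 'e. vsum x UNIV) -` {real (r UNIV)} \<inter>
      (\<Inter>F. (\<lambda>x. vsum x F) -` {..real (r F)}) = ?Q"
    by auto
  finally have "convex ?Q" .
  moreover have "?V \<subseteq> ?Q"
    using card_Int_le_rank by (auto simp: vsum_char_vec basis_iff)
  ultimately show "bases_polytope r \<subseteq> ?Q"
    unfolding bases_polytope_def by (intro hull_minimal)
  show "?Q \<subseteq> bases_polytope r"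
  proof (rule ccontr)
    assume "\<not> ?Q \<subseteq> bases_polytope r"
    then obtain z where z: "z \<in> ?Q" "z \<notin> convex hull ?V" by (auto simp: bases_polytope_def)
    have "closed (convex hull ?V)"
      by (intro compact_imp_closed compact_convex_hull finite_imp_compact) simp
    then obtain a b where ab: "inner a z < b" "\<And>x. x \<in> convex hull ?V \<Longrightarrow> b < inner a x"
      using separating_hyperplane_closed_point[of "convex hull ?V" z] z(2) by auto
    \<comment> \<open>The hull lies on the side where the functional is large while greedy
      maximizes, hence the negated weights.\<close>
    obtain B where B: "basis UNIV r B"
      and opt: "\<And>x::'e \<Rightarrow> real. sum x UNIV = r UNIV \<Longrightarrow> (\<And>F. sum x F \<le> r F) \<Longrightarrow>
        (\<Sum>e\<in>UNIV. - (a $ e) * x e) \<le> (\<Sum>e\<in>B. - (a $ e))"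
      using exists_optimal_basis[of "\<lambda>e. - (a $ e)"] by auto
    have "(\<Sum>e\<in>UNIV. - (a $ e) * z $ e) \<le> (\<Sum>e\<in>B. - (a $ e))"
      using z(1) by (intro opt) (auto simp: vsum_def)
    then have "inner a (char_vec B) \<le> inner a z"
      by (simp add: inner_vec_eq_sum char_vec_def sum_negf if_distrib sum.If_cases cong: if_cong)
    moreover have "char_vec B \<in> convex hull ?V" using B by (intro hull_inc) auto
    ultimately show False using ab by fastforce
  qed
qed

section \<open>Relative interior points and perturbation\<close>

text \<open>For nonempty \<open>\<B>\<close>, a relative interior point of the convex hull of the
  characteristic vectors.\<close>

definition centroid :: "'e::finite set set \<Rightarrow> real ^ 'e" where
  "centroid \<B> = (1 / card \<B>) *\<^sub>R (\<Sum>B\<in>\<B>. char_vec B)"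

lemma vsum_centroid: "vsum (centroid \<B>) F = (\<Sum>B\<in>\<B>. real (card (B \<inter> F))) / card \<B>"
  by (simp add: centroid_def vsum_scaleR vsum_sum vsum_char_vec)

lemma vsum_centroid_eq:
  assumes "\<B> \<noteq> {}" "\<And>B. B \<in> \<B> \<Longrightarrow> card (B \<inter> F) = k"
  shows "vsum (centroid \<B>) F = k"
  using assms by (simp add: vsum_centroid)

text \<open>One member below the bound suffices: the others cannot make up for it in the
  average.\<close>

lemma vsum_centroid_less:
  assumes "\<And>B. B \<in> \<B> \<Longrightarrow> card (B \<inter> F) \<le> k" "B \<in> \<B>" "card (B \<inter> F) < k"
  shows "vsum (centroid \<B>) F < k"
proof -
  have "(\<Sum>B\<in>\<B>. real (card (B \<inter> F))) < (\<Sum>B\<in>\<B>. real k)"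
    using assms by (intro sum_strict_mono_ex1) auto
  moreover have "card \<B> > 0" using assms(2) by (auto simp: card_gt_0_iff)
  ultimately show ?thesis by (simp add: vsum_centroid divide_less_eq mult.commute)
qed

text \<open>The intersection of finitely many open sets contains a ball around \<open>y\<close>. The
  sets will be the constraints that are strict at \<open>y\<close>.\<close>

lemma exists_pos_perturbation:
  fixes y d :: "'v::real_normed_vector"
  assumes "finite \<U>" "\<And>U. U \<in> \<U> \<Longrightarrow> open U \<and> y \<in> U"
  shows "\<exists>\<epsilon>>0. \<forall>U\<in>\<U>. y + \<epsilon> *\<^sub>R d \<in> U"
proof -
  have "open (\<Inter>\<U>)" "y \<in> \<Inter>\<U>" using assms by auto
  then obtain \<delta> where \<delta>: "\<delta> > 0" "ball y \<delta> \<subseteq> \<Inter>\<U>" by (meson open_contains_ball)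
  \<comment> \<open>The summand 1 keeps the denominator positive when \<open>d = 0\<close>.\<close>
  define \<epsilon> where "\<epsilon> = \<delta> / (norm d + 1)"
  have "norm d + 1 > 0" by (simp add: add_nonneg_pos)
  then have "\<epsilon> > 0" "norm (\<epsilon> *\<^sub>R d) < \<delta>"
    using \<delta>(1) by (simp_all add: \<epsilon>_def divide_less_eq)
  then have "y + \<epsilon> *\<^sub>R d \<in> ball y \<delta>" by (simp add: dist_norm)
  then show ?thesis using \<delta>(2) \<open>\<epsilon> > 0\<close> by blast
qed

section \<open>Systems of flacet constraints and their minimality\<close>

definition total_plane :: "('e::finite set \<Rightarrow> nat) \<Rightarrow> (real ^ 'e) set" where
  "total_plane r = {x. vsum x UNIV = r UNIV}"

definition upper_form :: "('e::finite set \<Rightarrow> nat) \<Rightarrow> 'e set \<Rightarrow> (real ^ 'e) set" where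
  "upper_form r F = {x. vsum x F \<le> r F}"

definition lower_form :: "('e::finite set \<Rightarrow> nat) \<Rightarrow> 'e set \<Rightarrow> (real ^ 'e) set" where
  "lower_form r F = {x. vsum x (UNIV - F) \<ge> real (r UNIV) - real (r F)}"

definition flacet_system ::
    "('e::finite set \<Rightarrow> nat) \<Rightarrow> 'e set set \<Rightarrow> 'e set set \<Rightarrow> (real ^ 'e) set set" where
  "flacet_system r T U = insert (total_plane r) (upper_form r ` T \<union> lower_form r ` U)"

lemma lower_form_iff: "x \<in> total_plane r \<Longrightarrow> x \<in> lower_form r F \<longleftrightarrow> x \<in> upper_form r F"
  by (auto simp: total_plane_def upper_form_def lower_form_def vsum_Compl)

locale connected_matroid_UNIV = connected_matroid "UNIV :: 'e::finite set" r
  for r :: "'e::finite set \<Rightarrow> nat"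
begin

text \<open>On the total plane the two forms agree, so only the union of \<open>T\<close> and
  \<open>U\<close> matters; \<open>flacets_suffice\<close> supplies the remaining rank
  constraints.\<close>

lemma flacet_system_describes:
  assumes "T \<union> U = {F. flacet UNIV r F}"
  shows "describes (flacet_system r T U) (bases_polytope r)"
proof -
  have "x \<in> \<Inter> (flacet_system r T U) \<longleftrightarrow>
      x \<in> total_plane r \<and> (\<forall>F. flacet UNIV r F \<longrightarrow> x \<in> upper_form r F)" for x
  proof -
    have "(\<forall>F. flacet UNIV r F \<longrightarrow> x \<in> upper_form r F) \<longleftrightarrow>
        (\<forall>F\<in>T. x \<in> upper_form r F) \<and> (\<forall>F\<in>U. x \<in> upper_form r F)"
      using assms by blast
    then show ?thesis using lower_form_iff[of x r] by (auto simp: flacet_system_def)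
  qed
  moreover have "x \<in> bases_polytope r \<longleftrightarrow>
      x \<in> total_plane r \<and> (\<forall>F. flacet UNIV r F \<longrightarrow> x \<in> upper_form r F)" for x
    using flacets_suffice[of "\<lambda>e. x $ e"]
    by (auto simp: bases_polytope_eq[OF matroid] total_plane_def upper_form_def vsum_def)
  ultimately show ?thesis by (auto simp: describes_def)
qed

lemma basis_card: "basis UNIV r B \<Longrightarrow> card (B \<inter> UNIV) = r UNIV"
  by (simp add: basis_iff)

lemma basis_card_Int_le: "basis UNIV r B \<Longrightarrow> card (B \<inter> F) \<le> r F"
  using card_Int_le_rank by (auto simp: basis_iff)

lemma flacet_nontrivial: "flacet UNIV r F \<Longrightarrow> F \<noteq> {} \<and> F \<noteq> UNIV"
  by (auto simp: flacet_def two_connected_def)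

text \<open>The centroid of all bases satisfies every flacet constraint strictly, so it can be moved
  off the plane along the all-ones vector without violating any.\<close>

lemma total_plane_irredundant:
  assumes "T \<union> U = {F. flacet UNIV r F}"
  shows "\<exists>z. z \<notin> total_plane r \<and> z \<in> \<Inter> (upper_form r ` T \<union> lower_form r ` U)"
proof -
  define \<B> where "\<B> = {B. basis UNIV r B}"
  define y where "y = centroid \<B>"
  obtain B where "basis UNIV r B" "card (B \<inter> UNIV) = r UNIV" "card (B \<inter> UNIV) = r UNIV"
    by (rule exists_basis_chain[OF order_refl order_refl])
  then have "\<B> \<noteq> {}" by (auto simp: \<B>_def)
  then have y: "vsum y UNIV = r UNIV"
    unfolding y_def by (intro vsum_centroid_eq) (auto simp: \<B>_def dest: basis_card)
  have strict: "vsum y F < r F" if F: "flacet UNIV r F" for F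
  proof -
    obtain B where "basis UNIV r B" "card (B \<inter> F) < r F"
      using exists_nontight_basis[of F] flacet_nontrivial[OF F] by auto
    then show ?thesis unfolding y_def
      by (intro vsum_centroid_less[of _ _ _ B]) (auto simp: \<B>_def basis_card_Int_le)
  qed
  \<comment> \<open>Off the plane the two forms differ, so both are kept strict.\<close>
  let ?\<U> = "(\<lambda>F. {x. vsum x F < r F}) ` {F. flacet UNIV r F} \<union>
    (\<lambda>F. {x. real (r UNIV) - real (r F) < vsum x (UNIV - F)}) ` {F. flacet UNIV r F}"
  define d :: "real ^ 'e" where "d = (\<chi> e. 1)"
  have "y \<in> V" if "V \<in> ?\<U>" for V
    using that strict y by (auto simp: vsum_Compl)
  moreover have "open V" if "V \<in> ?\<U>" for V
    using that by (auto intro: open_Collect_less continuous_on_vsum)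
  moreover have "finite ?\<U>" by simp
  ultimately have "\<exists>\<epsilon>>0. \<forall>V\<in>?\<U>. y + \<epsilon> *\<^sub>R d \<in> V"
    using exists_pos_perturbation[of ?\<U> y d] by presburger
  then obtain \<epsilon> where \<epsilon>: "\<epsilon> > 0" "\<forall>V\<in>?\<U>. y + \<epsilon> *\<^sub>R d \<in> V"
    by blast
  have "vsum d UNIV > 0" by (simp add: d_def vsum_def)
  then have "y + \<epsilon> *\<^sub>R d \<notin> total_plane r"
    using \<epsilon>(1) y by (simp add: total_plane_def vsum_add vsum_scaleR)
  moreover have "y + \<epsilon> *\<^sub>R d \<in> upper_form r F" "y + \<epsilon> *\<^sub>R d \<in> lower_form r F"
    if "flacet UNIV r F" for F
    using \<epsilon>(2) that by (simp_all add: ball_Un upper_form_def lower_form_def order_less_imp_le)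
  ultimately show ?thesis using assms by blast
qed

text \<open>The centroid of the bases tight on \<open>F\<close> satisfies the constraint of
  \<open>F\<close> with equality and, by \<open>flacet_determined_by_tight_bases\<close>, all others
  strictly.\<close>

lemma flacet_irredundant:
  assumes F: "flacet UNIV r F"
  shows "\<exists>z. z \<in> total_plane r \<and> z \<notin> upper_form r F \<and>
    (\<forall>G. flacet UNIV r G \<longrightarrow> G \<noteq> F \<longrightarrow> z \<in> upper_form r G)"
proof -
  define \<B> where "\<B> = {B. basis UNIV r B \<and> card (B \<inter> F) = r F}"
  define y where "y = centroid \<B>"
  obtain B where "basis UNIV r B" "card (B \<inter> F) = r F" "card (B \<inter> UNIV) = r UNIV"
    by (rule exists_basis_chain[OF subset_UNIV order_refl])
  then have "\<B> \<noteq> {}" by (auto simp: \<B>_def)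
  then have y: "vsum y UNIV = r UNIV" "vsum y F = r F"
    unfolding y_def by (rule vsum_centroid_eq; auto simp: \<B>_def basis_iff)+
  have strict: "vsum y G < r G" if G: "flacet UNIV r G" "G \<noteq> F" for G
  proof -
    have "G \<noteq> {}" "G \<noteq> UNIV" using flacet_nontrivial[OF G(1)] by auto
    from flacet_determined_by_tight_bases[OF F subset_UNIV this] G(2)
    have "\<not> (\<forall>B. basis UNIV r B \<longrightarrow> card (B \<inter> F) = r F \<longrightarrow> card (B \<inter> G) = r G)" by blast
    then obtain B where B: "basis UNIV r B" "card (B \<inter> F) = r F" "card (B \<inter> G) \<noteq> r G"
      by blast
    then have "card (B \<inter> G) < r G" using basis_card_Int_le[OF B(1), of G] by simp
    then show ?thesis unfolding y_def using B
      by (intro vsum_centroid_less[of _ _ _ B]) (auto simp: \<B>_def basis_card_Int_le)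
  qed
  obtain f g where fg: "f \<in> F" "g \<notin> F" using flacet_nontrivial[OF F] by auto
  \<comment> \<open>Shifting weight from \<open>g\<close> to \<open>f\<close> raises the sum over
    \<open>F\<close> and keeps the total.\<close>
  define d where "d = char_vec {f} + (-1) *\<^sub>R char_vec {g}"
  have d: "vsum d UNIV = 0" "vsum d F = 1"
    using fg unfolding d_def vsum_add vsum_scaleR vsum_char_vec by simp_all
  let ?\<U> = "(\<lambda>G. {x. vsum x G < r G}) ` {G. flacet UNIV r G \<and> G \<noteq> F}"
  have "y \<in> V" if "V \<in> ?\<U>" for V
    using that strict by auto
  moreover have "open V" if "V \<in> ?\<U>" for V
    using that by (auto intro: open_Collect_less continuous_on_vsum)
  moreover have "finite ?\<U>" by simp
  ultimately have "\<exists>\<epsilon>>0. \<forall>V\<in>?\<U>. y + \<epsilon> *\<^sub>R d \<in> V"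
    using exists_pos_perturbation[of ?\<U> y d] by presburger
  then obtain \<epsilon> where \<epsilon>: "\<epsilon> > 0" "\<forall>V\<in>?\<U>. y + \<epsilon> *\<^sub>R d \<in> V"
    by blast
  have "y + \<epsilon> *\<^sub>R d \<in> upper_form r G" if "flacet UNIV r G" "G \<noteq> F" for G
    using \<epsilon>(2) that by (simp add: upper_form_def order_less_imp_le)
  moreover have "y + \<epsilon> *\<^sub>R d \<in> total_plane r"
    unfolding total_plane_def mem_Collect_eq vsum_add vsum_scaleR y d by simp
  moreover have "y + \<epsilon> *\<^sub>R d \<notin> upper_form r F"
    unfolding upper_form_def mem_Collect_eq vsum_add vsum_scaleR y d using \<epsilon>(1) by simp
  ultimately show ?thesis by blast
qed

text \<open>A flacet in both \<open>T\<close> and \<open>U\<close> would appear in two forms that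
  are equivalent on the total plane; \<open>disj\<close> prevents this.\<close>

lemma flacet_system_minimal:
  assumes TU: "T \<union> U = {F. flacet UNIV r F}" and disj: "T \<inter> U = {}"
  shows "minimal_description (flacet_system r T U) (bases_polytope r)"
proof -
  let ?C = "flacet_system r T U"
  have irr: "\<Inter> (?C - {c}) \<noteq> \<Inter> ?C" if c: "c \<in> ?C" for c
  proof -
    have "\<exists>z. z \<in> \<Inter> (?C - {c}) \<and> z \<notin> c"
    proof (cases "c = total_plane r")
      case True
      obtain z where z: "z \<notin> total_plane r" "z \<in> \<Inter> (upper_form r ` T \<union> lower_form r ` U)"
        using total_plane_irredundant[OF TU] by blast
      have "?C - {c} \<subseteq> upper_form r ` T \<union> lower_form r ` U"
        using True by (auto simp: flacet_system_def)
      then show ?thesis using z True by blast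
    next
      case False
      then obtain F where F: "F \<in> T \<and> c = upper_form r F \<or> F \<in> U \<and> c = lower_form r F"
        using c by (auto simp: flacet_system_def)
      then have "flacet UNIV r F" using TU by blast
      then obtain z where z: "z \<in> total_plane r" "z \<notin> upper_form r F"
        and others: "\<And>G. flacet UNIV r G \<Longrightarrow> G \<noteq> F \<Longrightarrow> z \<in> upper_form r G"
        using flacet_irredundant by blast
      have "z \<notin> c" using F z lower_form_iff[OF z(1)] by blast
      moreover have "z \<in> b" if b: "b \<in> ?C" "b \<noteq> c" for b
      proof (cases "b = total_plane r")
        case False
        then obtain G where G: "G \<in> T \<and> b = upper_form r G \<or> G \<in> U \<and> b = lower_form r G"
          using b(1) by (auto simp: flacet_system_def)
        \<comment> \<open>For \<open>G = F\<close>, disjointness would force the same form and hence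
          \<open>b = c\<close>.\<close>
        then have "G \<noteq> F" using F b(2) disj by blast
        moreover have "flacet UNIV r G" using G TU by blast
        ultimately show ?thesis using others G lower_form_iff[OF z(1)] by blast
      qed (use z in simp)
      ultimately show ?thesis by blast
    qed
    then show ?thesis using c by blast
  qed
  then show ?thesis using flacet_system_describes[OF TU] by (simp add: minimal_description_def)
qed

end

section \<open>From flacets back to closures and locked subsets\<close>

text \<open>On two elements, the only parallel and the only coparallel closure of a connected
  matroid is the whole ground set, which is not essential, and there are no locked subsets. The
  system would be the equation alone.\<close>

theorem theorem3p2:
  fixes r :: "'e::finite set \<Rightarrow> nat"
    and \<P> \<S> \<L> :: "'e set set"
  assumes "matroid (UNIV :: 'e set) r"
    and "two_connected (UNIV :: 'e set) r"
    and "CARD('e) \<noteq> 2"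
    and "\<P> \<subseteq> essential_parallel_closures UNIV r"
    and "\<S> \<subseteq> essential_coparallel_closures UNIV r"
    and "\<L> \<subseteq> locked_subsets UNIV r"
  shows "describes (bases_system r \<P> \<S> \<L>) (bases_polytope r) \<and>
    (no_facet_twice r \<P> \<S> \<longrightarrow>
      minimal_description (bases_system r \<P> \<S> \<L>) (bases_polytope r))"
proof -
  interpret connected_matroid_UNIV r by unfold_locales (rule assms)+
  let ?P = "essential_parallel_closures UNIV r"
  let ?S = "essential_coparallel_closures UNIV r"
  let ?L = "locked_subsets UNIV r"
  \<comment> \<open>A coparallel closure \<open>S\<close> stands for the flacet
    \<open>UNIV - S\<close>. Its form in \<open>\<S>\<close> is the lower form of that flacet, so
    \<open>\<S>\<close> contributes to \<open>U\<close> and its complement to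
    \<open>T\<close>.\<close>
  define T where "T = \<P> \<union> {F. UNIV - F \<in> ?S - \<S>} \<union> \<L>"
  define U where "U = (?P - \<P>) \<union> {F. UNIV - F \<in> \<S>} \<union> (?L - \<L>)"
  have TU: "T \<union> U = {F. flacet UNIV r F}"
    using assms(4-6) flacet_iff[OF assms(3)] by (auto simp: T_def U_def)
  have rank_P: "r P = 1" if "P \<in> ?P" for P
    using that by (simp add: essential_parallel_closures_def parallel_closure_def)
  have dual_S: "dual_rank UNIV r S = 1" if "S \<in> ?S" for S
    using that by (simp add: essential_coparallel_closures_def coparallel_closure_def
        parallel_closure_def)
  have upper_P: "{x. vsum x P \<le> 1} = upper_form r P"
    and lower_P: "{x. vsum x (UNIV - P) \<ge> real (r UNIV) - 1} = lower_form r P" if "P \<in> ?P" for P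
    using rank_P[OF that] by (simp_all add: upper_form_def lower_form_def)
  have lower_S: "{x. vsum x (UNIV - F) \<ge> real (card (UNIV - F)) - 1} = lower_form r F"
    if "UNIV - F \<in> ?S" for F
  proof -
    \<comment> \<open>This is dual rank 1 of \<open>UNIV - F\<close>, written additively.\<close>
    have "real (card (UNIV - F)) - 1 = real (r UNIV) - real (r F)"
      using dual_rank_add[of "UNIV - F"] dual_S[OF that] by (simp add: double_diff)
    then show ?thesis by (simp add: lower_form_def)
  qed
  \<comment> \<open>Indexes the coparallel constraints by flacets instead of their
    complements.\<close>
  have reindex: "{f S |S. S \<in> A} = (\<lambda>F. f (UNIV - F)) ` {F. UNIV - F \<in> A}"
    for f :: "'e set \<Rightarrow> (real ^ 'e) set" and A
  proof -
    have "{F. UNIV - F \<in> A} = (\<lambda>S. UNIV - S) ` A"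
    proof
      show "{F. UNIV - F \<in> A} \<subseteq> (\<lambda>S. UNIV - S) ` A"
        by (rule subsetI, rule_tac x = "UNIV - x" in image_eqI) (simp_all add: double_diff)
    qed (auto simp: double_diff)
    then show ?thesis by (simp add: image_image double_diff Setcompr_eq_image)
  qed
  have "{{x. vsum x P \<le> 1} | P. P \<in> \<P>} = upper_form r ` \<P>"
    unfolding Setcompr_eq_image using upper_P assms(4) by (intro image_cong) auto
  moreover have "{{x. vsum x (UNIV - P) \<ge> real (r UNIV) - 1} | P. P \<in> ?P - \<P>} =
      lower_form r ` (?P - \<P>)"
    unfolding Setcompr_eq_image using lower_P by (intro image_cong) auto
  moreover have "{{x. vsum x S \<ge> real (card S) - 1} | S. S \<in> \<S>} =
      lower_form r ` {F. UNIV - F \<in> \<S>}"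
    unfolding reindex using assms(5) by (intro image_cong refl lower_S) auto
  moreover have "{{x. vsum x (UNIV - S) \<le> real (r (UNIV - S))} | S. S \<in> ?S - \<S>} =
      upper_form r ` {F. UNIV - F \<in> ?S - \<S>}"
    unfolding reindex by (intro image_cong) (simp_all add: double_diff upper_form_def)
  moreover have "{{x. vsum x L \<le> real (r L)} | L. L \<in> \<L>} = upper_form r ` \<L>"
    unfolding Setcompr_eq_image upper_form_def ..
  moreover have "{{x. vsum x (UNIV - L) \<ge> real (r UNIV) - real (r L)} | L. L \<in> ?L - \<L>} =
      lower_form r ` (?L - \<L>)"
    unfolding Setcompr_eq_image lower_form_def ..
  moreover have "{k} \<union> a \<union> b \<union> c \<union> d \<union> e \<union> f = insert k (a \<union> d \<union> e \<union> (b \<union> c \<union> f))"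
    for k :: "(real ^ 'e) set" and a b c d e f
    by blast
  ultimately have system: "bases_system r \<P> \<S> \<L> = flacet_system r T U"
    unfolding bases_system_def flacet_system_def T_def U_def image_Un total_plane_def
    by (simp only:)
  have "T \<inter> U = {}" if no_twice: "no_facet_twice r \<P> \<S>"
  proof -
    \<comment> \<open>Locked subsets have both ranks at least 2, so only a parallel closure
      complementary to a coparallel one can be listed in two classes.\<close>
    have "F \<notin> ?P \<and> UNIV - F \<notin> ?S" if "F \<in> ?L" for F
      using that rank_P[of F] dual_S[of "UNIV - F"] by (auto simp: locked_subsets_def)
    moreover have "F \<in> \<P> \<longleftrightarrow> UNIV - F \<notin> \<S>" if "F \<in> ?P" "UNIV - F \<in> ?S" for F
      using no_twice that unfolding no_facet_twice_def by blast
    ultimately show ?thesis using assms(4-6) unfolding T_def U_def by blast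
  qed
  then show ?thesis
    unfolding system using flacet_system_describes[OF TU] flacet_system_minimal[OF TU] by blast
qed

end
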